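(* For any finite Markov decision process, the turnpike function $N:[0,1)\to\mathbb{N}^+$ is upper semicontinuous at each regular point $\alpha\in[0,1)$, and therefore it is upper semicontinuous on each partition interval.
   Context: A finite Markov decision process (MDP) has a finite state set $\mathbb{X}=\{x^1,\ldots,x^m\}$, a finite nonempty action set $A(x)$ for each $x\in\mathbb{X}$, real one-step rewards $r(x,a)$, transition probabilities $p(\cdot|x,a)$ on $\mathbb{X}$, and a terminal reward $s:\mathbb{X}\to\mathbb{R}$. $\mathbb{F}$ is the set of decision rules (identified with deterministic policies), i.e. maps $\phi$ on $\mathbb{X}$ with $\phi(x)\in A(x)$. Functions on $\mathbb{X}$ are identified with vectors in $\mathbb{R}^m$. $P(\phi)$ is the stochastic matrix with entries $p(x^j|x^i,\phi(x^i))$ and $r(\phi)(x)=r(x,\phi(x))$. For $\alpha\in[0,1)$: $v_\alpha^\phi=\sum_{t=0}^\infty\alpha^tP(\phi)^tr(\phi)$; $V_\alpha(x)=\max_{\phi\in\mathbb{F}}v_\alpha^\phi(x)$; $T_\alpha^\phi V=r(\phi)+\alpha P(\phi)V$ for $V\in\mathbb{R}^m$; $V_{0,\alpha}=s$ and $V_{n,\alpha}(x)=\max_{\phi\in\mathbb{F}}T_\alpha^\phi V_{n-1,\alpha}(x)$ for $n\ge1$ ($n$-horizon value function). Put $D_n(\alpha)=\{\phi\in\mathbb{F}:V_{n,\alpha}=T_\alpha^\phi V_{n-1,\alpha}\}$ for $n\in\mathbb{N}^+=\{1,2,\ldots\}$, $D(\alpha)=\{\phi\in\mathbb{F}:V_\alpha=v_\alpha^\phi\}$,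 and $D(E)=\bigcup_{\alpha\in E}D(\alpha)$ for $E\subset[0,1)$. The turnpike integer $N(\alpha)$ is the smallest positive integer such that $D_n(\alpha)\subset D(\alpha)$ for all $n\ge N(\alpha)$ (it is known to exist); $N(\cdot)$ is the turnpike function. Let $D(0-)=\emptyset$, $D(\alpha-)=\bigcap_{i\ge1}D((\alpha-\frac1i,\alpha)\cap[0,1))$ for $\alpha\in(0,1)$, and $D(\alpha+)=\bigcap_{i\ge1}D((\alpha,\alpha+\frac1i)\cap[0,1))$ for $\alpha\in[0,1)$. A point $\alpha\in(0,1)$ is a break point if $D(\alpha-)\ne D(\alpha+)$; $\alpha\in[0,1)$ is a touching point if $D(\alpha)\ne D(\alpha-)\cup D(\alpha+)$. A point is irregular if it is a break or touching point, and regular otherwise. There are finitely many irregular points; let $a_1<\cdots<a_{l-1}$ be those in $(0,1)$, $a_0=0$, $a_l=1$. The open intervals $(a_i,a_{i+1})$, $0\le i\le l-1$, are the partition intervals; $D(\cdot)$ is constant on each of them. Semicontinuity at $0$ is with respect to the domain $[0,1)$. *)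

theory Defs
  imports "HOL-Analysis.Analysis" "HOL-Probability.Probability_Mass_Function"
begin

text \<open>
  The finite nonempty state set is the type \<open>'x::finite\<close>, so that functions on states are
  vectors in \<open>real^'x\<close>. Rewards and transition laws at pairs (x, a) with a not in
  \<open>actions M x\<close> are junk: nothing below refers to them.
\<close>

record ('x, 'a) mdp =
  actions :: "'x \<Rightarrow> 'a set"
  reward :: "'x \<Rightarrow> 'a \<Rightarrow> real"
  transition :: "'x \<Rightarrow> 'a \<Rightarrow> 'x pmf"
  terminal :: "'x \<Rightarrow> real"

definition finite_mdp :: "('x::finite, 'a) mdp \<Rightarrow> bool" where
  "finite_mdp M \<longleftrightarrow> (\<forall>x. finite (actions M x) \<and> actions M x \<noteq> {})"

definition decision_rules :: "('x::finite, 'a) mdp \<Rightarrow> ('x \<Rightarrow> 'a) set" where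
  "decision_rules M = {\<phi>. \<forall>x. \<phi> x \<in> actions M x}"

definition reward_vec :: "('x::finite, 'a) mdp \<Rightarrow> ('x \<Rightarrow> 'a) \<Rightarrow> real^'x" where
  "reward_vec M \<phi> = (\<chi> x. reward M x (\<phi> x))"

definition transition_mat :: "('x::finite, 'a) mdp \<Rightarrow> ('x \<Rightarrow> 'a) \<Rightarrow> real^'x^'x" where
  "transition_mat M \<phi> = (\<chi> x y. pmf (transition M x (\<phi> x)) y)"

text \<open>The library's \<open>A ^ t\<close> on \<open>real^'x^'x\<close> is the componentwise power.\<close>

definition matrix_power :: "real^'x^'x \<Rightarrow> nat \<Rightarrow> real^'x^'x::finite" where
  "matrix_power A t = (((**) A) ^^ t) (mat 1)"

definition policy_value :: "('x::finite, 'a) mdp \<Rightarrow> real \<Rightarrow> ('x \<Rightarrow> 'a) \<Rightarrow> real^'x" where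
  "policy_value M \<alpha> \<phi> =
     (\<Sum>t. \<alpha> ^ t *\<^sub>R (matrix_power (transition_mat M \<phi>) t *v reward_vec M \<phi>))"

definition opt_value :: "('x::finite, 'a) mdp \<Rightarrow> real \<Rightarrow> real^'x" where
  "opt_value M \<alpha> = (\<chi> x. Max ((\<lambda>\<phi>. policy_value M \<alpha> \<phi> $ x) ` decision_rules M))"

definition bellman_op ::
  "('x::finite, 'a) mdp \<Rightarrow> real \<Rightarrow> ('x \<Rightarrow> 'a) \<Rightarrow> real^'x \<Rightarrow> real^'x" where
  "bellman_op M \<alpha> \<phi> V = reward_vec M \<phi> + \<alpha> *\<^sub>R (transition_mat M \<phi> *v V)"

primrec horizon_value :: "('x::finite, 'a) mdp \<Rightarrow> real \<Rightarrow> nat \<Rightarrow> real^'x" where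
  "horizon_value M \<alpha> 0 = (\<chi> x. terminal M x)"
| "horizon_value M \<alpha> (Suc n) =
     (\<chi> x. Max ((\<lambda>\<phi>. bellman_op M \<alpha> \<phi> (horizon_value M \<alpha> n) $ x) ` decision_rules M))"

text \<open>\<open>horizon_opt\<close> is the set \<open>D\<^sub>n(\<alpha>)\<close>; it is only meant for \<open>n \<ge> 1\<close>.\<close>

definition horizon_opt :: "('x::finite, 'a) mdp \<Rightarrow> nat \<Rightarrow> real \<Rightarrow> ('x \<Rightarrow> 'a) set" where
  "horizon_opt M n \<alpha> =
     {\<phi> \<in> decision_rules M.
        horizon_value M \<alpha> n = bellman_op M \<alpha> \<phi> (horizon_value M \<alpha> (n - 1))}"

definition discount_opt :: "('x::finite, 'a) mdp \<Rightarrow> real \<Rightarrow> ('x \<Rightarrow> 'a) set" where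
  "discount_opt M \<alpha> = {\<phi> \<in> decision_rules M. opt_value M \<alpha> = policy_value M \<alpha> \<phi>}"

definition discount_opt_set :: "('x::finite, 'a) mdp \<Rightarrow> real set \<Rightarrow> ('x \<Rightarrow> 'a) set" where
  "discount_opt_set M E = (\<Union>\<alpha>\<in>E. discount_opt M \<alpha>)"

definition turnpike :: "('x::finite, 'a) mdp \<Rightarrow> real \<Rightarrow> nat" where
  "turnpike M \<alpha> = (LEAST N. N \<ge> 1 \<and> (\<forall>n\<ge>N. horizon_opt M n \<alpha> \<subseteq> discount_opt M \<alpha>))"

definition discount_opt_left :: "('x::finite, 'a) mdp \<Rightarrow> real \<Rightarrow> ('x \<Rightarrow> 'a) set" where
  "discount_opt_left M \<alpha> =
     (if \<alpha> = 0 then {}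
      else (\<Inter>i\<in>{1::nat..}. discount_opt_set M ({\<alpha> - 1 / real i<..<\<alpha>} \<inter> {0..<1})))"

definition discount_opt_right :: "('x::finite, 'a) mdp \<Rightarrow> real \<Rightarrow> ('x \<Rightarrow> 'a) set" where
  "discount_opt_right M \<alpha> =
     (\<Inter>i\<in>{1::nat..}. discount_opt_set M ({\<alpha><..<\<alpha> + 1 / real i} \<inter> {0..<1}))"

definition break_point :: "('x::finite, 'a) mdp \<Rightarrow> real \<Rightarrow> bool" where
  "break_point M \<alpha> \<longleftrightarrow> \<alpha> \<in> {0<..<1} \<and> discount_opt_left M \<alpha> \<noteq> discount_opt_right M \<alpha>"

definition touching_point :: "('x::finite, 'a) mdp \<Rightarrow> real \<Rightarrow> bool" where
  "touching_point M \<alpha> \<longleftrightarrow>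
     \<alpha> \<in> {0..<1} \<and> discount_opt M \<alpha> \<noteq> discount_opt_left M \<alpha> \<union> discount_opt_right M \<alpha>"

definition irregular_point :: "('x::finite, 'a) mdp \<Rightarrow> real \<Rightarrow> bool" where
  "irregular_point M \<alpha> \<longleftrightarrow> break_point M \<alpha> \<or> touching_point M \<alpha>"

definition regular_point :: "('x::finite, 'a) mdp \<Rightarrow> real \<Rightarrow> bool" where
  "regular_point M \<alpha> \<longleftrightarrow> \<alpha> \<in> {0..<1} \<and> \<not> irregular_point M \<alpha>"

text \<open>
  \<open>a 0 < \<dots> < a l\<close> is the increasing enumeration of the irregular points in (0,1) together with
  the end points 0 and 1; it exists and is unique because there are finitely many irregular points.
\<close>

definition partition_intervals :: "('x::finite, 'a) mdp \<Rightarrow> real set set" where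
  "partition_intervals M =
     {{a i<..<a (Suc i)} | (a :: nat \<Rightarrow> real) l i.
        strict_mono_on {0..l} a \<and> a 0 = 0 \<and> a l = 1 \<and>
        a ` {0<..<l} = {\<alpha> \<in> {0<..<1}. irregular_point M \<alpha>} \<and> i < l}"

definition usc_at_within ::
  "'a::topological_space \<Rightarrow> 'a set \<Rightarrow> ('a \<Rightarrow> real) \<Rightarrow> bool" where
  "usc_at_within x S f \<longleftrightarrow> (\<forall>c>f x. \<forall>\<^sub>F y in at x within S. f y < c)"

definition usc_on :: "'a::topological_space set \<Rightarrow> ('a \<Rightarrow> real) \<Rightarrow> bool" where
  "usc_on S f \<longleftrightarrow> (\<forall>x\<in>S. usc_at_within x S f)"

end

theory Submission
  imports Defs "HOL-Complex_Analysis.Conformal_Mappings"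
begin

text \<open>
  Each component of \<open>policy_value M \<beta> \<phi>\<close> is a power series in \<open>\<beta>\<close> with bounded coefficients, so the
  difference of two policy values does not change sign close to \<open>\<alpha>\<close> on either side of \<open>\<alpha>\<close>.
  At a regular point this gives \<open>D(\<alpha>) \<subseteq> D(\<beta>)\<close> for all \<open>\<beta>\<close> near \<open>\<alpha>\<close>.
  Moreover the Bellman operator is a contraction that is Lipschitz in the discount factor, so the
  horizon values at \<open>\<beta>\<close> tend to \<open>opt_value M \<alpha>\<close> as \<open>n \<rightarrow> \<infinity>\<close> and \<open>\<beta> \<rightarrow> \<alpha>\<close> jointly. A rule
  \<open>\<phi> \<notin> D(\<alpha>)\<close> violates the optimality equation at \<open>\<alpha>\<close>, so it stays outside \<open>D\<^sub>n(\<beta>)\<close> for all large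
  \<open>n\<close> and all \<open>\<beta>\<close> near \<open>\<alpha>\<close>; for each of the finitely many remaining \<open>n \<ge> N(\<alpha>)\<close>, continuity gives
  \<open>D\<^sub>n(\<beta>) \<subseteq> D\<^sub>n(\<alpha>) \<subseteq> D(\<alpha>)\<close>.
\<close>

section \<open>Zeros of real power series\<close>

lemma summable_bounded_powser:
  fixes c :: "nat \<Rightarrow> 'b::{real_normed_field,banach}"
  assumes "\<And>t. norm (c t) \<le> K" "norm z < 1"
  shows "summable (\<lambda>t. c t * z ^ t)"
proof (rule summable_comparison_test)
  show "\<exists>N. \<forall>n\<ge>N. norm (c n * z ^ n) \<le> K * norm z ^ n"
    using assms(1) by (auto simp: norm_mult norm_power intro!: mult_right_mono)
  show "summable (\<lambda>n. K * norm z ^ n)"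
    using assms(2) by (intro summable_mult summable_geometric) auto
qed

text \<open>Bounded coefficients make the series converge on the whole complex unit disc. Zeros
  accumulating at \<alpha> would force this holomorphic extension to vanish identically, by the
  identity theorem.\<close>

lemma bounded_powser_eventually_nonzero:
  fixes c :: "nat \<Rightarrow> real" and f :: "real \<Rightarrow> real"
  assumes c: "\<And>t. \<bar>c t\<bar> \<le> K" and f: "\<And>\<beta>. \<bar>\<beta>\<bar> < 1 \<Longrightarrow> (\<lambda>t. c t * \<beta> ^ t) sums f \<beta>"
    and \<alpha>: "\<bar>\<alpha>\<bar> < 1" and nz: "\<bar>\<beta>\<bar> < 1" "f \<beta> \<noteq> 0"
  shows "\<forall>\<^sub>F x in at \<alpha>. f x \<noteq> 0"
proof (rule ccontr)
  assume "\<not> ?thesis"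
  then have freq: "\<exists>\<^sub>F x in at \<alpha>. f x = 0"
    by (simp add: frequently_def)
  define F where "F z = (\<Sum>t. of_real (c t) * z ^ t)" for z :: complex
  have F: "(\<lambda>t. of_real (c t) * z ^ t) sums F z" if "norm z < 1" for z
    unfolding F_def by (intro summable_sums summable_bounded_powser) (use c that in auto)
  have Ff: "F (of_real x) = of_real (f x)" if "\<bar>x\<bar> < 1" for x
    using sums_of_real[OF f[OF that], where 'a = complex] F[of "of_real x"] that
    by (auto dest: sums_unique2)
  have hol: "F holomorphic_on ball 0 1"
    by (rule power_series_holomorphic[where a = "\<lambda>t. of_real (c t)"]) (use F in auto)
  \<comment> \<open>The real zeros, embedded in the complex plane, serve as the set with a limit
    point in the identity theorem.\<close>
  define U where "U = complex_of_real ` {x. \<bar>x\<bar> < 1 \<and> f x = 0}"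
  have "\<forall>\<^sub>F x in at \<alpha>. \<bar>x\<bar> < 1"
  proof -
    have "((\<lambda>x. \<bar>x\<bar>) \<longlongrightarrow> \<bar>\<alpha>\<bar>) (at \<alpha>)" by (intro tendsto_intros)
    with \<alpha> show ?thesis by (rule order_tendstoD(2)[rotated])
  qed
  with freq have freq': "\<exists>\<^sub>F x in at \<alpha>. \<bar>x\<bar> < 1 \<and> f x = 0"
    by (auto dest: frequently_eventually_frequently simp: conj_commute)
  have "complex_of_real \<alpha> islimpt U"
    unfolding islimpt_approachable
  proof (intro allI impI)
    fix e :: real assume "e > 0"
    then have "\<forall>\<^sub>F x in at \<alpha>. x \<noteq> \<alpha> \<and> dist x \<alpha> < e"
      by (auto simp: eventually_at)
    from frequently_eventually_frequently[OF freq' this] obtain x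
      where "\<bar>x\<bar> < 1" "f x = 0" "x \<noteq> \<alpha>" "dist x \<alpha> < e"
      by (auto dest: frequently_ex)
    then show "\<exists>x'\<in>U. x' \<noteq> complex_of_real \<alpha> \<and> dist x' (complex_of_real \<alpha>) < e"
      by (auto simp: U_def dist_of_real)
  qed
  moreover have "U \<subseteq> ball 0 1"
    by (auto simp: U_def)
  moreover have "F z = 0" if "z \<in> U" for z
    using that by (auto simp: U_def Ff)
  ultimately have "F (of_real \<beta>) = 0"
    using analytic_continuation[OF hol, of U "of_real \<alpha>" "of_real \<beta>"] \<alpha> nz by simp
  with Ff nz show False by auto
qed

text \<open>The positive product says that neither point equals \<alpha> and that both lie on the
  same side of it, so left and right neighbourhoods are treated together.\<close>

definition near_same_side :: "real \<Rightarrow> real \<Rightarrow> real \<Rightarrow> real \<Rightarrow> bool" where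
  "near_same_side \<alpha> e \<beta> \<gamma> \<longleftrightarrow> \<bar>\<beta> - \<alpha>\<bar> < e \<and> \<bar>\<gamma> - \<alpha>\<bar> < e \<and> 0 < (\<beta> - \<alpha>) * (\<gamma> - \<alpha>)"

lemma near_same_side_segment:
  assumes "near_same_side \<alpha> e \<beta> \<gamma>" "x \<in> closed_segment \<beta> \<gamma>"
  shows "x \<noteq> \<alpha>" "\<bar>x - \<alpha>\<bar> < e"
  using assms
  by (auto simp: near_same_side_def closed_segment_eq_real_ivl zero_less_mult_iff split: if_splits)

text \<open>Either \<open>f\<close> vanishes on all of (-1,1), or it has no zero in a punctured
  neighbourhood of \<alpha>. In the second case the segment from \<beta> to \<gamma> avoids
  \<alpha>, and the intermediate value theorem excludes a sign change. Quantifying over small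
  \<open>e\<close> by a filter lets finitely many such statements share one
  \<open>e\<close>.\<close>

lemma bounded_powser_sign_persists:
  fixes c :: "nat \<Rightarrow> real" and f :: "real \<Rightarrow> real"
  assumes c: "\<And>t. \<bar>c t\<bar> \<le> K" and f: "\<And>\<beta>. \<bar>\<beta>\<bar> < 1 \<Longrightarrow> (\<lambda>t. c t * \<beta> ^ t) sums f \<beta>"
    and \<alpha>: "\<bar>\<alpha>\<bar> < 1"
  shows "\<forall>\<^sub>F e in at_right 0. \<forall>\<beta> \<gamma>. near_same_side \<alpha> e \<beta> \<gamma> \<longrightarrow>
           \<bar>\<beta>\<bar> < 1 \<longrightarrow> \<bar>\<gamma>\<bar> < 1 \<longrightarrow> 0 \<le> f \<beta> \<longrightarrow> 0 \<le> f \<gamma>"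
proof (cases "\<exists>\<beta>. \<bar>\<beta>\<bar> < 1 \<and> f \<beta> \<noteq> 0")
  case False
  then show ?thesis by simp
next
  case True
  then have "\<forall>\<^sub>F x in at \<alpha>. f x \<noteq> 0"
    using bounded_powser_eventually_nonzero[OF c f \<alpha>] by blast
  then obtain d where d: "d > 0" "\<And>x. x \<noteq> \<alpha> \<Longrightarrow> dist x \<alpha> < d \<Longrightarrow> f x \<noteq> 0"
    by (auto simp: eventually_at)
  have cont: "isCont f x" if "\<bar>x\<bar> < 1" for x
  proof -
    have "(f has_field_derivative (\<Sum>t. diffs c t * x ^ t)) (at x)"
    proof (rule has_field_derivative_transform_within_open)
      show "((\<lambda>x. \<Sum>t. c t * x ^ t) has_field_derivative (\<Sum>t. diffs c t * x ^ t)) (at x)"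
        by (rule termdiffs_strong'[of 1]) (use that f in \<open>auto intro: sums_summable\<close>)
      show "(\<Sum>t. c t * y ^ t) = f y" if "y \<in> {-1<..<1}" for y
        using f[of y] that by (simp add: sums_iff abs_less_iff)
    qed (use that in auto)
    then show ?thesis by (rule DERIV_isCont)
  qed
  have "\<forall>\<^sub>F e in at_right 0. e < d"
    using d(1) by (auto simp: eventually_at_right_field)
  then show ?thesis
  proof eventually_elim
    case (elim e)
    show ?case
    proof (intro allI impI)
      fix \<beta> \<gamma> assume side: "near_same_side \<alpha> e \<beta> \<gamma>" and lt: "\<bar>\<beta>\<bar> < 1" "\<bar>\<gamma>\<bar> < 1" and "0 \<le> f \<beta>"
      have nz: "f x \<noteq> 0" if "x \<in> closed_segment \<beta> \<gamma>" for x
        using near_same_side_segment[OF side that] elim by (intro d(2)) (auto simp: dist_real_def)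
      have "connected (f ` closed_segment \<beta> \<gamma>)"
      proof (intro connected_continuous_image continuous_at_imp_continuous_on ballI cont)
        show "\<bar>x\<bar> < 1" if "x \<in> closed_segment \<beta> \<gamma>" for x
          using that lt by (auto simp: closed_segment_eq_real_ivl split: if_splits)
      qed auto
      \<comment> \<open>If \<open>f \<gamma>\<close> were at most 0, this interval would contain 0,
        which the image of the segment omits.\<close>
      then have "{f \<gamma>..f \<beta>} \<subseteq> f ` closed_segment \<beta> \<gamma>"
        by (rule connected_contains_Icc) auto
      moreover have "0 \<notin> f ` closed_segment \<beta> \<gamma>"
        using nz by force
      ultimately have "0 \<notin> {f \<gamma>..f \<beta>}" by blast
      with \<open>0 \<le> f \<beta>\<close> show "0 \<le> f \<gamma>" by simp
    qed
  qed
qed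

section \<open>Value functions\<close>

lemma transition_mat_vec:
  "(transition_mat M \<phi> *v V) $ x = (\<Sum>y\<in>UNIV. pmf (transition M x (\<phi> x)) y * V $ y)"
  by (simp add: transition_mat_def matrix_vector_mult_def)

lemma sum_pmf_UNIV [simp]: "(\<Sum>y\<in>UNIV. pmf p y) = (1 :: real)" for p :: "'x::finite pmf"
  by (rule sum_pmf_eq_1) auto

lemma pmf_average_le:
  fixes p :: "'x::finite pmf"
  assumes "\<And>y. f y \<le> (d::real)"
  shows "(\<Sum>y\<in>UNIV. pmf p y * f y) \<le> d"
proof -
  have "(\<Sum>y\<in>UNIV. pmf p y * f y) \<le> (\<Sum>y\<in>UNIV. pmf p y * d)"
    using assms by (intro sum_mono mult_left_mono) auto
  then show ?thesis by (simp flip: sum_distrib_right)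
qed

lemma pmf_average_abs_le:
  fixes p :: "'x::finite pmf"
  assumes "\<And>y. \<bar>f y\<bar> \<le> (d::real)"
  shows "\<bar>\<Sum>y\<in>UNIV. pmf p y * f y\<bar> \<le> d"
proof -
  have "(\<Sum>y\<in>UNIV. pmf p y * - f y) \<le> d"
    by (rule pmf_average_le) (use assms in \<open>auto simp: abs_le_iff\<close>)
  moreover have "(\<Sum>y\<in>UNIV. pmf p y * f y) \<le> d"
    by (rule pmf_average_le) (use assms in \<open>auto simp: abs_le_iff\<close>)
  ultimately show ?thesis by (simp add: sum_negf abs_le_iff)
qed

lemma vec_bounded: "\<exists>K\<ge>0. \<forall>x. \<bar>V $ x\<bar> \<le> K" for V :: "real^'x::finite"
  using component_le_norm_cart norm_ge_zero by blast

lemma matrix_power_0 [simp]: "matrix_power A 0 = mat 1"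
  and matrix_power_Suc [simp]: "matrix_power A (Suc t) = A ** matrix_power A t"
  by (simp_all add: matrix_power_def)

text \<open>These expected rewards at time \<open>t\<close> are the power series coefficients of the
  policy value in the discount factor.\<close>

definition reward_seq :: "('x::finite, 'a) mdp \<Rightarrow> ('x \<Rightarrow> 'a) \<Rightarrow> nat \<Rightarrow> real^'x" where
  "reward_seq M \<phi> t = matrix_power (transition_mat M \<phi>) t *v reward_vec M \<phi>"

lemma reward_seq_0 [simp]: "reward_seq M \<phi> 0 = reward_vec M \<phi>"
  and reward_seq_Suc: "reward_seq M \<phi> (Suc t) = transition_mat M \<phi> *v reward_seq M \<phi> t"
  by (simp_all add: reward_seq_def matrix_vector_mul_assoc)

text \<open>Averaging with a stochastic matrix does not increase the maximum norm, so a bound on the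
  rewards bounds every coefficient.\<close>

lemma reward_seq_bounded: "\<exists>K. \<forall>t x. \<bar>reward_seq M \<phi> t $ x\<bar> \<le> K"
proof -
  obtain K where K: "\<And>x. \<bar>reward_vec M \<phi> $ x\<bar> \<le> K"
    using vec_bounded by blast
  have "\<bar>reward_seq M \<phi> t $ x\<bar> \<le> K" for t x
    by (induction t arbitrary: x)
      (auto simp: reward_seq_Suc transition_mat_vec K intro: pmf_average_abs_le)
  then show ?thesis by blast
qed

lemma policy_value_sums:
  assumes "\<bar>\<alpha>\<bar> < 1"
  shows "(\<lambda>t. \<alpha> ^ t *\<^sub>R reward_seq M \<phi> t) sums policy_value M \<alpha> \<phi>"
proof -
  obtain K where K: "\<And>t x. \<bar>reward_seq M \<phi> t $ x\<bar> \<le> K"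
    using reward_seq_bounded by blast
  have "summable (\<lambda>t. reward_seq M \<phi> t $ x * \<alpha> ^ t)" for x
    by (rule summable_bounded_powser) (use K assms in auto)
  then have "(\<lambda>t. (\<alpha> ^ t *\<^sub>R reward_seq M \<phi> t) $ x) sums (\<Sum>t. reward_seq M \<phi> t $ x * \<alpha> ^ t)" for x
    by (simp add: mult.commute summable_sums)
  then have "(\<lambda>t. \<alpha> ^ t *\<^sub>R reward_seq M \<phi> t) sums (\<chi> x. \<Sum>t. reward_seq M \<phi> t $ x * \<alpha> ^ t)"
    unfolding sums_def by (intro vec_tendstoI) (simp add: sum_component)
  then show ?thesis
    by (simp add: policy_value_def reward_seq_def sums_iff)
qed

lemma policy_value_component_sums:
  assumes "\<bar>\<alpha>\<bar> < 1"
  shows "(\<lambda>t. reward_seq M \<phi> t $ x * \<alpha> ^ t) sums (policy_value M \<alpha> \<phi> $ x)"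
  using bounded_linear.sums[OF bounded_linear_vec_nth policy_value_sums[OF assms]]
  by (simp add: mult.commute)

lemma bellman_op_nth:
  "bellman_op M \<alpha> \<phi> V $ x =
     reward M x (\<phi> x) + \<alpha> * (\<Sum>y\<in>UNIV. pmf (transition M x (\<phi> x)) y * V $ y)"
  by (simp add: bellman_op_def transition_mat_vec reward_vec_def)

text \<open>The term at \<open>t = 0\<close> is the reward; the remaining series is the discounted
  transition matrix applied to the whole series.\<close>

lemma bellman_op_policy_value:
  assumes "\<bar>\<alpha>\<bar> < 1"
  shows "bellman_op M \<alpha> \<phi> (policy_value M \<alpha> \<phi>) = policy_value M \<alpha> \<phi>"
proof -
  have "bounded_linear (\<lambda>V. \<alpha> *\<^sub>R (transition_mat M \<phi> *v V))"
    by (intro bounded_linear_compose[OF bounded_linear_scaleR_right]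
        matrix_vector_mul_bounded_linear)
  from bounded_linear.sums[OF this policy_value_sums[OF assms]]
  have "(\<lambda>t. \<alpha> ^ Suc t *\<^sub>R reward_seq M \<phi> (Suc t)) sums
      (\<alpha> *\<^sub>R (transition_mat M \<phi> *v policy_value M \<alpha> \<phi>))"
    by (simp add: reward_seq_Suc matrix_vector_mult_scaleR)
  then have "(\<lambda>t. \<alpha> ^ t *\<^sub>R reward_seq M \<phi> t) sums
      (\<alpha> *\<^sub>R (transition_mat M \<phi> *v policy_value M \<alpha> \<phi>) + reward_vec M \<phi>)"
    using sums_Suc[of "\<lambda>t. \<alpha> ^ t *\<^sub>R reward_seq M \<phi> t"] by simp
  with policy_value_sums[OF assms, of M \<phi>] show ?thesis
    by (auto simp: bellman_op_def add.commute dest: sums_unique2)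
qed

text \<open>Minimum principle: at a state minimising \<open>d\<close>, the hypothesis reads \<open>(1 - \<alpha>) * d \<ge> 0\<close>.\<close>

lemma nonneg_of_discounted_average:
  fixes d :: "real^'x::finite"
  assumes \<alpha>: "0 \<le> \<alpha>" "\<alpha> < 1"
    and d: "\<And>x. \<alpha> * (\<Sum>y\<in>UNIV. pmf (p x) y * d $ y) \<le> d $ x"
  shows "0 \<le> d $ x"
proof -
  obtain x0 where x0: "\<And>y. d $ x0 \<le> d $ y"
    using ex_min_if_finite[of "range (($) d)"] by (force simp: not_less)
  have "(\<Sum>y\<in>UNIV. pmf (p x0) y * - d $ y) \<le> - d $ x0"
    by (rule pmf_average_le) (use x0 in auto)
  then have "\<alpha> * d $ x0 \<le> \<alpha> * (\<Sum>y\<in>UNIV. pmf (p x0) y * d $ y)"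
    using \<alpha>(1) by (intro mult_left_mono) (auto simp: sum_negf)
  with d[of x0] have "0 \<le> (1 - \<alpha>) * d $ x0"
    by (simp add: algebra_simps)
  with \<alpha> x0[of x] show ?thesis
    by (simp add: zero_le_mult_iff)
qed

text \<open>The policy value is a fixed point of \<open>bellman_op\<close>, so \<open>V\<close>
  minus that value dominates its own discounted average and the minimum principle applies.\<close>

lemma policy_value_le:
  assumes \<alpha>: "0 \<le> \<alpha>" "\<alpha> < 1" and V: "\<And>x. bellman_op M \<alpha> \<phi> V $ x \<le> V $ x"
  shows "policy_value M \<alpha> \<phi> $ x \<le> V $ x"
proof -
  let ?v = "policy_value M \<alpha> \<phi>"
  have fixp: "bellman_op M \<alpha> \<phi> ?v $ x = ?v $ x" for x
    using bellman_op_policy_value[of \<alpha> M \<phi>] \<alpha> by simp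
  have "0 \<le> (V - ?v) $ x"
    by (rule nonneg_of_discounted_average[OF \<alpha>, where p = "\<lambda>x. transition M x (\<phi> x)"])
      (use V fixp in \<open>auto simp: bellman_op_nth right_diff_distrib sum_subtractf, smt\<close>)
  then show ?thesis by simp
qed

lemma policy_value_ge:
  assumes \<alpha>: "0 \<le> \<alpha>" "\<alpha> < 1" and V: "\<And>x. V $ x \<le> bellman_op M \<alpha> \<phi> V $ x"
  shows "V $ x \<le> policy_value M \<alpha> \<phi> $ x"
proof -
  let ?v = "policy_value M \<alpha> \<phi>"
  have fixp: "bellman_op M \<alpha> \<phi> ?v $ x = ?v $ x" for x
    using bellman_op_policy_value[of \<alpha> M \<phi>] \<alpha> by simp
  have "0 \<le> (?v - V) $ x"
    by (rule nonneg_of_discounted_average[OF \<alpha>, where p = "\<lambda>x. transition M x (\<phi> x)"])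
      (use V fixp in \<open>auto simp: bellman_op_nth right_diff_distrib sum_subtractf, smt\<close>)
  then show ?thesis by simp
qed

lemma policy_value_unique:
  assumes "0 \<le> \<alpha>" "\<alpha> < 1" "bellman_op M \<alpha> \<phi> V = V"
  shows "policy_value M \<alpha> \<phi> = V"
  using policy_value_le[OF assms(1,2), of M \<phi> V] policy_value_ge[OF assms(1,2), of V M \<phi>] assms(3)
  by (auto simp: vec_eq_iff intro: antisym)


section \<open>Decision rules and the optimality equation\<close>

text \<open>This isolates one step of the \<open>horizon_value\<close> recursion, so that the
  optimality equation for \<open>opt_value\<close> can be expressed with the same operator.\<close>

definition bellman_opt :: "('x::finite, 'a) mdp \<Rightarrow> real \<Rightarrow> real^'x \<Rightarrow> real^'x" where
  "bellman_opt M \<alpha> V = (\<chi> x. Max ((\<lambda>\<phi>. bellman_op M \<alpha> \<phi> V $ x) ` decision_rules M))"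

lemma horizon_value_Suc: "horizon_value M \<alpha> (Suc n) = bellman_opt M \<alpha> (horizon_value M \<alpha> n)"
  by (simp add: bellman_opt_def)

context
  fixes M :: "('x::finite, 'a) mdp"
  assumes fin: "finite_mdp M"
begin

lemma finite_decision_rules: "finite (decision_rules M)"
proof -
  have "decision_rules M = PiE UNIV (actions M)"
    by (auto simp: decision_rules_def)
  then show ?thesis
    using fin by (simp add: finite_PiE finite_mdp_def)
qed

lemma decision_rules_nonempty: "decision_rules M \<noteq> {}"
proof -
  have "\<forall>x. \<exists>a. a \<in> actions M x"
    using fin by (auto simp: finite_mdp_def)
  then obtain \<phi> where "\<And>x. \<phi> x \<in> actions M x"
    by metis
  then show ?thesis by (auto simp: decision_rules_def)
qed

lemma bellman_op_le_bellman_opt: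
  assumes "\<phi> \<in> decision_rules M"
  shows "bellman_op M \<alpha> \<phi> V $ x \<le> bellman_opt M \<alpha> V $ x"
  using assms finite_decision_rules by (simp add: bellman_opt_def)

lemma bellman_opt_attained_at:
  obtains \<phi> where "\<phi> \<in> decision_rules M" "bellman_opt M \<alpha> V $ x = bellman_op M \<alpha> \<phi> V $ x"
proof -
  have "bellman_opt M \<alpha> V $ x \<in> (\<lambda>\<phi>. bellman_op M \<alpha> \<phi> V $ x) ` decision_rules M"
    unfolding bellman_opt_def vec_lambda_beta
    using finite_decision_rules decision_rules_nonempty by (intro Max_in) auto
  with that show thesis by auto
qed

text \<open>The component \<open>x\<close> of \<open>bellman_op M \<alpha> \<phi> V\<close> depends on \<open>\<phi>\<close> only through \<open>\<phi> x\<close>, so the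
  maximisers of the separate components can be glued.\<close>

lemma bellman_opt_attained:
  obtains \<phi> where "\<phi> \<in> decision_rules M" "bellman_opt M \<alpha> V = bellman_op M \<alpha> \<phi> V"
proof -
  have "\<exists>\<phi>\<in>decision_rules M. bellman_opt M \<alpha> V $ x = bellman_op M \<alpha> \<phi> V $ x" for x
    using bellman_opt_attained_at[of \<alpha> V x] by blast
  then obtain \<Phi> where \<Phi>: "\<And>x. \<Phi> x \<in> decision_rules M"
    "\<And>x. bellman_opt M \<alpha> V $ x = bellman_op M \<alpha> (\<Phi> x) V $ x"
    by metis
  have "(\<lambda>x. \<Phi> x x) \<in> decision_rules M"
    using \<Phi>(1) by (auto simp: decision_rules_def)
  moreover have "bellman_opt M \<alpha> V = bellman_op M \<alpha> (\<lambda>x. \<Phi> x x) V"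
    using \<Phi>(2) by (simp add: vec_eq_iff bellman_op_nth)
  ultimately show thesis by (rule that)
qed

text \<open>Policy improvement: a rule that is greedy for the value of \<phi> has a value at least
  as large in every component. If \<phi> maximises the sum of components, no component can increase,
  so the greedy rule has the same value and the optimality equation holds.\<close>

lemma optimal_policy_exists:
  assumes \<alpha>: "0 \<le> \<alpha>" "\<alpha> < 1"
  obtains \<phi> where "\<phi> \<in> decision_rules M"
    "bellman_opt M \<alpha> (policy_value M \<alpha> \<phi>) = policy_value M \<alpha> \<phi>"
proof -
  let ?v = "policy_value M \<alpha>"
  \<comment> \<open>A scalar objective is used because a rule maximal in all components at once is
    not yet available.\<close>
  define S where "S \<phi> = (\<Sum>x\<in>UNIV. ?v \<phi> $ x)" for \<phi>
  have "Max (S ` decision_rules M) \<in> S ` decision_rules M"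
    using finite_decision_rules decision_rules_nonempty by (intro Max_in) auto
  then obtain \<phi> where \<phi>: "\<phi> \<in> decision_rules M" and "S \<phi> = Max (S ` decision_rules M)"
    by auto
  then have S_max: "S \<psi> \<le> S \<phi>" if "\<psi> \<in> decision_rules M" for \<psi>
    using that finite_decision_rules by simp
  obtain \<psi> where \<psi>: "\<psi> \<in> decision_rules M" "bellman_opt M \<alpha> (?v \<phi>) = bellman_op M \<alpha> \<psi> (?v \<phi>)"
    by (rule bellman_opt_attained)
  have improve: "?v \<phi> $ x \<le> bellman_op M \<alpha> \<psi> (?v \<phi>) $ x" for x
    using bellman_op_le_bellman_opt[OF \<phi>, of \<alpha> "?v \<phi>" x] bellman_op_policy_value[of \<alpha> M \<phi>] \<alpha> \<psi>(2)
    by simp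
  have le: "?v \<phi> $ x \<le> ?v \<psi> $ x" for x
    by (rule policy_value_ge[OF \<alpha> improve])
  have "?v \<phi> $ x = ?v \<psi> $ x" for x
  proof (rule ccontr)
    assume "?v \<phi> $ x \<noteq> ?v \<psi> $ x"
    with le[of x] have "S \<phi> < S \<psi>"
      unfolding S_def using le by (intro sum_strict_mono_ex1) (auto simp: less_le)
    with S_max[OF \<psi>(1)] show False by simp
  qed
  then have "?v \<psi> = ?v \<phi>" by (simp add: vec_eq_iff)
  then have "bellman_opt M \<alpha> (?v \<phi>) = ?v \<phi>"
    using bellman_op_policy_value[of \<alpha> M \<psi>] \<alpha> \<psi>(2) by simp
  with \<phi> show thesis by (rule that)
qed

lemma policy_value_le_opt_value:
  assumes "\<phi> \<in> decision_rules M"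
  shows "policy_value M \<alpha> \<phi> $ x \<le> opt_value M \<alpha> $ x"
  using assms finite_decision_rules by (simp add: opt_value_def)

text \<open>A policy value solving the optimality equation satisfies the hypothesis of
  \<open>policy_value_le\<close> for every rule, so it dominates all policy values and equals
  \<open>opt_value\<close>.\<close>

lemma bellman_opt_opt_value:
  assumes \<alpha>: "0 \<le> \<alpha>" "\<alpha> < 1"
  shows "bellman_opt M \<alpha> (opt_value M \<alpha>) = opt_value M \<alpha>"
proof -
  obtain \<phi> where \<phi>: "\<phi> \<in> decision_rules M"
    "bellman_opt M \<alpha> (policy_value M \<alpha> \<phi>) = policy_value M \<alpha> \<phi>"
    by (rule optimal_policy_exists[OF \<alpha>])
  have "policy_value M \<alpha> \<psi> $ x \<le> policy_value M \<alpha> \<phi> $ x" if "\<psi> \<in> decision_rules M" for \<psi> x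
    by (rule policy_value_le[OF \<alpha>])
      (use bellman_op_le_bellman_opt[OF that, of \<alpha> "policy_value M \<alpha> \<phi>"] \<phi>(2) in simp)
  then have "opt_value M \<alpha> = policy_value M \<alpha> \<phi>"
    unfolding opt_value_def vec_eq_iff vec_lambda_beta
    using \<phi>(1) finite_decision_rules by (intro allI Max_eqI) auto
  with \<phi>(2) show ?thesis by simp
qed

text \<open>Optimality becomes finitely many sign conditions on differences of policy values, to
  which the power series result applies.\<close>

lemma discount_opt_iff_policy_value_ge:
  "\<phi> \<in> discount_opt M \<alpha> \<longleftrightarrow>
     \<phi> \<in> decision_rules M \<and>
     (\<forall>\<psi>\<in>decision_rules M. \<forall>x. 0 \<le> policy_value M \<alpha> \<phi> $ x - policy_value M \<alpha> \<psi> $ x)"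
  (is "?L \<longleftrightarrow> ?R")
proof
  assume ?L
  then have "\<phi> \<in> decision_rules M" "policy_value M \<alpha> \<phi> = opt_value M \<alpha>"
    by (auto simp: discount_opt_def)
  then show ?R
    by (simp add: policy_value_le_opt_value)
next
  assume ?R
  then have "opt_value M \<alpha> = policy_value M \<alpha> \<phi>"
    unfolding opt_value_def vec_eq_iff vec_lambda_beta
    using finite_decision_rules by (intro allI Max_eqI) auto
  with \<open>?R\<close> show ?L by (simp add: discount_opt_def)
qed

text \<open>The fixed point of \<open>bellman_op\<close> is unique. The contrapositive is what is
  needed later: a rule that is not optimal violates the optimality equation.\<close>

lemma discount_opt_of_bellman_op:
  assumes "0 \<le> \<alpha>" "\<alpha> < 1" "\<phi> \<in> decision_rules M"
    "bellman_op M \<alpha> \<phi> (opt_value M \<alpha>) = opt_value M \<alpha>"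
  shows "\<phi> \<in> discount_opt M \<alpha>"
  using assms policy_value_unique[of \<alpha> M \<phi> "opt_value M \<alpha>"] by (simp add: discount_opt_def)

section \<open>Discount-optimal policies near a regular point\<close>

lemma policy_value_diff_sign_persists:
  assumes "\<bar>\<alpha>\<bar> < 1"
  shows "\<forall>\<^sub>F e in at_right 0. \<forall>\<beta> \<gamma>. near_same_side \<alpha> e \<beta> \<gamma> \<longrightarrow>
           \<bar>\<beta>\<bar> < 1 \<longrightarrow> \<bar>\<gamma>\<bar> < 1 \<longrightarrow>
           0 \<le> policy_value M \<beta> \<phi> $ x - policy_value M \<beta> \<psi> $ x \<longrightarrow>
           0 \<le> policy_value M \<gamma> \<phi> $ x - policy_value M \<gamma> \<psi> $ x"
proof -
  obtain K where K: "\<And>t x. \<bar>reward_seq M \<phi> t $ x\<bar> \<le> K"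
    using reward_seq_bounded by blast
  obtain L where L: "\<And>t x. \<bar>reward_seq M \<psi> t $ x\<bar> \<le> L"
    using reward_seq_bounded by blast
  define c where "c t = reward_seq M \<phi> t $ x - reward_seq M \<psi> t $ x" for t
  show ?thesis
  proof (rule bounded_powser_sign_persists[where c = c and K = "K + L"])
    show "\<bar>c t\<bar> \<le> K + L" for t
      using K[of t x] L[of t x] by (simp add: c_def)
    show "(\<lambda>t. c t * \<beta> ^ t) sums (policy_value M \<beta> \<phi> $ x - policy_value M \<beta> \<psi> $ x)"
      if "\<bar>\<beta>\<bar> < 1" for \<beta>
      unfolding c_def left_diff_distrib
      using that by (intro sums_diff policy_value_component_sums)
  qed (rule assms)
qed

text \<open>One \<open>e\<close> serves all pairs of rules and all states, as there are finitely
  many. Exchanging \<beta> and \<gamma> turns the inclusion into equality.\<close>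

lemma discount_opt_locally_constant:
  assumes "0 \<le> \<alpha>" "\<alpha> < 1"
  shows "\<forall>\<^sub>F e in at_right 0. \<forall>\<beta>\<in>{0..<1}. \<forall>\<gamma>\<in>{0..<1}.
           near_same_side \<alpha> e \<beta> \<gamma> \<longrightarrow> discount_opt M \<beta> \<subseteq> discount_opt M \<gamma>"
proof -
  define Q where "Q \<phi> \<psi> x e \<longleftrightarrow> (\<forall>\<beta> \<gamma>. near_same_side \<alpha> e \<beta> \<gamma> \<longrightarrow>
           \<bar>\<beta>\<bar> < 1 \<longrightarrow> \<bar>\<gamma>\<bar> < 1 \<longrightarrow>
           0 \<le> policy_value M \<beta> \<phi> $ x - policy_value M \<beta> \<psi> $ x \<longrightarrow>
           0 \<le> policy_value M \<gamma> \<phi> $ x - policy_value M \<gamma> \<psi> $ x)" for \<phi> \<psi> x e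
  have Q: "\<forall>\<^sub>F e in at_right 0. Q \<phi> \<psi> x e" for \<phi> \<psi> x
    unfolding Q_def by (rule policy_value_diff_sign_persists) (use assms in simp)
  have "\<forall>\<^sub>F e in at_right 0. \<forall>\<phi>\<in>decision_rules M. \<forall>\<psi>\<in>decision_rules M. \<forall>x. Q \<phi> \<psi> x e"
    by (simp add: eventually_ball_finite_distrib[OF finite_decision_rules] eventually_all_finite Q)
  then show ?thesis
  proof eventually_elim
    case (elim e)
    show ?case
    proof (intro ballI impI subsetI)
      fix \<beta> \<gamma> \<phi>
      assume *: "\<beta> \<in> {0..<1}" "\<gamma> \<in> {0..<1}" "near_same_side \<alpha> e \<beta> \<gamma>" "\<phi> \<in> discount_opt M \<beta>"
      have abs: "\<bar>\<beta>\<bar> < 1" "\<bar>\<gamma>\<bar> < 1"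
        using *(1,2) by auto
      from *(4) have \<phi>: "\<phi> \<in> decision_rules M"
        and ge: "\<And>\<psi> x. \<psi> \<in> decision_rules M \<Longrightarrow> 0 \<le> policy_value M \<beta> \<phi> $ x - policy_value M \<beta> \<psi> $ x"
        unfolding discount_opt_iff_policy_value_ge by blast+
      show "\<phi> \<in> discount_opt M \<gamma>"
        unfolding discount_opt_iff_policy_value_ge
      proof (intro conjI ballI allI \<phi>)
        fix \<psi> x assume \<psi>: "\<psi> \<in> decision_rules M"
        with elim \<phi> have "Q \<phi> \<psi> x e" by blast
        then show "0 \<le> policy_value M \<gamma> \<phi> $ x - policy_value M \<gamma> \<psi> $ x"
          using *(3) abs ge[OF \<psi>] unfolding Q_def by blast
      qed
    qed
  qed
qed

text \<open>Without touching, D(\<alpha>) is the union of the two one-sided limit sets; without a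
  break these coincide when \<alpha> > 0, while at 0 the left one is empty. Hence D(\<alpha>) equals
  the limit set on each available side, and that set is contained in D(\<beta>) for \<beta> near
  \<alpha> on that side.\<close>

lemma discount_opt_regular_subset:
  assumes reg: "regular_point M \<alpha>"
  obtains e where "e > 0"
    "\<And>\<beta>. \<beta> \<in> {0..<1} \<Longrightarrow> \<bar>\<beta> - \<alpha>\<bar> < e \<Longrightarrow> discount_opt M \<alpha> \<subseteq> discount_opt M \<beta>"
proof -
  have \<alpha>: "0 \<le> \<alpha>" "\<alpha> < 1" and nbreak: "\<not> break_point M \<alpha>" and ntouch: "\<not> touching_point M \<alpha>"
    using reg by (auto simp: regular_point_def irregular_point_def)
  have "\<forall>\<^sub>F e in at_right 0. e > (0::real)"
    by (simp add: eventually_at_right_less)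
  from eventually_happens'[OF trivial_limit_at_right_real
      eventually_conj[OF this discount_opt_locally_constant[OF \<alpha>]]]
  obtain e where "e > 0" and const: "\<And>\<beta> \<gamma>. \<beta> \<in> {0..<1} \<Longrightarrow> \<gamma> \<in> {0..<1} \<Longrightarrow>
      near_same_side \<alpha> e \<beta> \<gamma> \<Longrightarrow> discount_opt M \<beta> \<subseteq> discount_opt M \<gamma>"
    by blast
  obtain k where "inverse (real (Suc k)) < e"
    using reals_Archimedean[OF \<open>e > 0\<close>] by blast
  define n where "n = Suc k"
  have n: "n \<in> {1..}" "1 / real n < e"
    using \<open>inverse (real (Suc k)) < e\<close> by (simp_all add: n_def inverse_eq_divide)
  \<comment> \<open>Membership in the limit set only gives optimality at some \<beta> in the window
    of width \<open>1 / real n\<close>; \<open>const\<close> transports it to every \<gamma> on that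
    side.\<close>
  have left: "discount_opt_left M \<alpha> \<subseteq> discount_opt M \<gamma>" if "\<gamma> \<in> {\<alpha> - e<..<\<alpha>} \<inter> {0..<1}" for \<gamma>
  proof
    have "\<alpha> \<noteq> 0" using that by auto
    fix \<phi> assume "\<phi> \<in> discount_opt_left M \<alpha>"
    then have "\<phi> \<in> discount_opt_set M ({\<alpha> - 1 / real n<..<\<alpha>} \<inter> {0..<1})"
      using n(1) unfolding discount_opt_left_def if_not_P[OF \<open>\<alpha> \<noteq> 0\<close>] by blast
    then obtain \<beta> where "\<phi> \<in> discount_opt M \<beta>" "\<beta> \<in> {\<alpha> - 1 / real n<..<\<alpha>} \<inter> {0..<1}"
      unfolding discount_opt_set_def by blast
    then show "\<phi> \<in> discount_opt M \<gamma>"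
      using const[of \<beta> \<gamma>] n(2) that
      by (auto simp: near_same_side_def zero_less_mult_iff)
  qed
  have right: "discount_opt_right M \<alpha> \<subseteq> discount_opt M \<gamma>" if "\<gamma> \<in> {\<alpha><..<\<alpha> + e} \<inter> {0..<1}" for \<gamma>
  proof
    fix \<phi> assume "\<phi> \<in> discount_opt_right M \<alpha>"
    then have "\<phi> \<in> discount_opt_set M ({\<alpha><..<\<alpha> + 1 / real n} \<inter> {0..<1})"
      using n(1) unfolding discount_opt_right_def by blast
    then obtain \<beta> where "\<phi> \<in> discount_opt M \<beta>" "\<beta> \<in> {\<alpha><..<\<alpha> + 1 / real n} \<inter> {0..<1}"
      unfolding discount_opt_set_def by blast
    then show "\<phi> \<in> discount_opt M \<gamma>"
      using const[of \<beta> \<gamma>] n(2) that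
      by (auto simp: near_same_side_def zero_less_mult_iff)
  qed
  have D: "discount_opt M \<alpha> = discount_opt_left M \<alpha> \<union> discount_opt_right M \<alpha>"
    using ntouch \<alpha> unfolding touching_point_def by force
  have D_left: "discount_opt_left M \<alpha> = discount_opt_right M \<alpha>" if "0 < \<alpha>"
    using that nbreak \<alpha> unfolding break_point_def by force
  have D_zero: "discount_opt_left M \<alpha> = {}" if "\<alpha> = 0"
    using that unfolding discount_opt_left_def by (rule if_P)
  have "discount_opt M \<alpha> \<subseteq> discount_opt M \<beta>" if "\<beta> \<in> {0..<1}" "\<bar>\<beta> - \<alpha>\<bar> < e" for \<beta>
  proof (cases \<beta> \<alpha> rule: linorder_cases)
    case less
    with that have "0 < \<alpha>" "\<beta> \<in> {\<alpha> - e<..<\<alpha>} \<inter> {0..<1}" by auto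
    from left[OF this(2)] D D_left[OF this(1)] show ?thesis by simp
  next
    case greater
    with that have "\<beta> \<in> {\<alpha><..<\<alpha> + e} \<inter> {0..<1}" by auto
    note right[OF this]
    moreover have "discount_opt M \<alpha> = discount_opt_right M \<alpha>"
      using D D_left D_zero \<alpha>(1) by (cases "\<alpha> = 0") simp_all
    ultimately show ?thesis by (rule ord_eq_le_trans[rotated])
  qed simp
  with \<open>e > 0\<close> show thesis by (rule that)
qed

section \<open>Finite-horizon values near a discount factor\<close>

text \<open>The rewards cancel, and the difference splits into the effect of changing the vector and
  that of changing the discount factor.\<close>

lemma bellman_op_perturb:
  assumes "0 \<le> \<beta>" and VW: "\<And>y. \<bar>V $ y - W $ y\<bar> \<le> d" and W: "\<And>y. \<bar>W $ y\<bar> \<le> K"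
  shows "\<bar>bellman_op M \<beta> \<phi> V $ x - bellman_op M \<alpha> \<phi> W $ x\<bar> \<le> \<beta> * d + \<bar>\<beta> - \<alpha>\<bar> * K"
proof -
  let ?E = "\<lambda>V. \<Sum>y\<in>UNIV. pmf (transition M x (\<phi> x)) y * V $ y"
  have "bellman_op M \<beta> \<phi> V $ x - bellman_op M \<alpha> \<phi> W $ x =
      \<beta> * (\<Sum>y\<in>UNIV. pmf (transition M x (\<phi> x)) y * (V $ y - W $ y)) + (\<beta> - \<alpha>) * ?E W"
    by (simp add: bellman_op_nth right_diff_distrib sum_subtractf) (simp add: algebra_simps)
  moreover have "\<bar>\<beta> * (\<Sum>y\<in>UNIV. pmf (transition M x (\<phi> x)) y * (V $ y - W $ y))\<bar> \<le> \<beta> * d"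
    unfolding abs_mult using assms(1) by (intro mult_mono pmf_average_abs_le VW) auto
  moreover have "\<bar>(\<beta> - \<alpha>) * ?E W\<bar> \<le> \<bar>\<beta> - \<alpha>\<bar> * K"
    unfolding abs_mult by (intro mult_left_mono pmf_average_abs_le W) auto
  ultimately show ?thesis by linarith
qed

text \<open>The maximiser of either side is a competitor on the other side, so the bound for a fixed
  rule carries over to the maxima.\<close>

lemma bellman_opt_perturb:
  assumes "0 \<le> \<beta>" "\<And>y. \<bar>V $ y - W $ y\<bar> \<le> d" "\<And>y. \<bar>W $ y\<bar> \<le> K"
  shows "\<bar>bellman_opt M \<beta> V $ x - bellman_opt M \<alpha> W $ x\<bar> \<le> \<beta> * d + \<bar>\<beta> - \<alpha>\<bar> * K"
proof -
  note perturb = bellman_op_perturb[where \<alpha> = \<alpha>, OF assms]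
  obtain \<phi> where \<phi>: "\<phi> \<in> decision_rules M" "bellman_opt M \<beta> V $ x = bellman_op M \<beta> \<phi> V $ x"
    by (rule bellman_opt_attained_at)
  obtain \<psi> where \<psi>: "\<psi> \<in> decision_rules M" "bellman_opt M \<alpha> W $ x = bellman_op M \<alpha> \<psi> W $ x"
    by (rule bellman_opt_attained_at)
  show ?thesis
    using perturb[where \<phi> = \<phi> and x = x] perturb[where \<phi> = \<psi> and x = x] \<phi>(2) \<psi>(2)
      bellman_op_le_bellman_opt[OF \<phi>(1), of \<alpha> W x] bellman_op_le_bellman_opt[OF \<psi>(1), of \<beta> V x]
    by linarith
qed

lemma tendsto_bellman_op:
  assumes "(b \<longlongrightarrow> \<alpha>) F" "(V \<longlongrightarrow> W) F"
  shows "((\<lambda>z. bellman_op M (b z) \<phi> (V z)) \<longlongrightarrow> bellman_op M \<alpha> \<phi> W) F"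
  unfolding bellman_op_def
  by (intro tendsto_intros assms bounded_linear.tendsto[OF matrix_vector_mul_bounded_linear])

lemma tendsto_horizon_value:
  "((\<lambda>\<beta>. horizon_value M \<beta> n) \<longlongrightarrow> horizon_value M \<alpha> n) (at \<alpha> within {0..<1})"
proof (induction n)
  case 0
  then show ?case by simp
next
  case (Suc n)
  let ?V = "\<lambda>\<beta>. horizon_value M \<beta> n" and ?F = "at \<alpha> within {0..<1}"
  obtain K where K: "\<And>y. \<bar>?V \<alpha> $ y\<bar> \<le> K"
    using vec_bounded by blast
  have "((\<lambda>\<beta>. bellman_opt M \<beta> (?V \<beta>) $ x) \<longlongrightarrow> bellman_opt M \<alpha> (?V \<alpha>) $ x) ?F" for x
  proof (rule LIM_zero_cancel, rule Lim_null_comparison)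
    show "((\<lambda>\<beta>. \<beta> * norm (?V \<beta> - ?V \<alpha>) + \<bar>\<beta> - \<alpha>\<bar> * K) \<longlongrightarrow> 0) ?F"
      using Suc by (auto intro!: tendsto_eq_intros)
    have "\<forall>\<^sub>F \<beta> in ?F. \<beta> \<in> {0..<1}"
      by (simp add: eventually_at_filter)
    then show "\<forall>\<^sub>F \<beta> in ?F. norm (bellman_opt M \<beta> (?V \<beta>) $ x - bellman_opt M \<alpha> (?V \<alpha>) $ x)
        \<le> \<beta> * norm (?V \<beta> - ?V \<alpha>) + \<bar>\<beta> - \<alpha>\<bar> * K"
    proof eventually_elim
      case (elim \<beta>)
      have "\<bar>?V \<beta> $ y - ?V \<alpha> $ y\<bar> \<le> norm (?V \<beta> - ?V \<alpha>)" for y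
        using component_le_norm_cart[of "?V \<beta> - ?V \<alpha>" y] by simp
      then show ?case
        using bellman_opt_perturb[of \<beta> "?V \<beta>" "?V \<alpha>" _ K x \<alpha>] K elim by simp
    qed
  qed
  then show ?case
    unfolding horizon_value_Suc by (rule vec_tendstoI)
qed

text \<open>The second summand solves
  \<open>s = \<gamma> * s + \<bar>\<beta> - \<alpha>\<bar> * K\<close>, so it absorbs the error
  added in each iteration. Using \<gamma> in place of \<beta> makes the decay rate uniform in
  \<beta>.\<close>

lemma horizon_value_error:
  assumes \<alpha>: "0 \<le> \<alpha>" "\<alpha> < 1" and \<beta>: "0 \<le> \<beta>" "\<beta> \<le> \<gamma>" "\<gamma> < 1"
    and C: "\<And>y. \<bar>terminal M y - opt_value M \<alpha> $ y\<bar> \<le> C" and K: "\<And>y. \<bar>opt_value M \<alpha> $ y\<bar> \<le> K"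
  shows "\<bar>horizon_value M \<beta> n $ x - opt_value M \<alpha> $ x\<bar> \<le> \<gamma> ^ n * C + \<bar>\<beta> - \<alpha>\<bar> * K / (1 - \<gamma>)"
proof (induction n arbitrary: x)
  case 0
  have "0 \<le> K" using K[of x] by linarith
  then show ?case
    using C[of x] \<beta> by (simp add: add_increasing2)
next
  case (Suc n)
  let ?d = "\<gamma> ^ n * C + \<bar>\<beta> - \<alpha>\<bar> * K / (1 - \<gamma>)"
  have "\<bar>bellman_opt M \<beta> (horizon_value M \<beta> n) $ x - bellman_opt M \<alpha> (opt_value M \<alpha>) $ x\<bar>
      \<le> \<beta> * ?d + \<bar>\<beta> - \<alpha>\<bar> * K"
    by (rule bellman_opt_perturb[OF \<beta>(1) Suc.IH K])
  also have "\<dots> \<le> \<gamma> * ?d + \<bar>\<beta> - \<alpha>\<bar> * K"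
    \<comment> \<open>Replacing the factor \<beta> by \<gamma> needs \<open>?d\<close> nonnegative,
      which holds because \<open>?d\<close> bounds an absolute value.\<close>
    using order_trans[OF abs_ge_zero Suc.IH] \<beta>(2) by (intro add_right_mono mult_right_mono) auto
  also have "\<dots> = \<gamma> ^ Suc n * C + \<bar>\<beta> - \<alpha>\<bar> * K / (1 - \<gamma>)"
    using \<beta>(3) by (simp add: field_simps)
  finally show ?case
    by (simp only: horizon_value_Suc bellman_opt_opt_value[OF \<alpha>])
qed

text \<open>The limit is joint in the horizon and the discount factor. The filter on discount
  factors does not exclude \<alpha> itself, so the case \<beta> = \<alpha> is covered too.\<close>

lemma tendsto_horizon_value_opt_value:
  assumes \<alpha>: "0 \<le> \<alpha>" "\<alpha> < 1"
  shows "((\<lambda>z. horizon_value M (snd z) (fst z)) \<longlongrightarrow> opt_value M \<alpha>)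
           (sequentially \<times>\<^sub>F inf (nhds \<alpha>) (principal {0..<1}))"
    (is "(_ \<longlongrightarrow> _) (_ \<times>\<^sub>F ?G)")
proof -
  \<comment> \<open>The midpoint of \<alpha> and 1 bounds all discount factors near \<alpha> away
    from 1.\<close>
  define \<gamma> where "\<gamma> = (1 + \<alpha>) / 2"
  have \<gamma>: "0 \<le> \<gamma>" "\<alpha> < \<gamma>" "\<gamma> < 1" using \<alpha> by (auto simp: \<gamma>_def)
  obtain K where K: "\<And>y. \<bar>opt_value M \<alpha> $ y\<bar> \<le> K"
    using vec_bounded by blast
  obtain C where "\<And>y. \<bar>(horizon_value M \<alpha> 0 - opt_value M \<alpha>) $ y\<bar> \<le> C"
    using vec_bounded by blast
  then have C: "\<And>y. \<bar>terminal M y - opt_value M \<alpha> $ y\<bar> \<le> C" by simp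
  have lim_n: "filterlim fst sequentially (sequentially \<times>\<^sub>F ?G)"
    by (rule filterlim_fst)
  have lim_\<beta>: "filterlim snd (nhds \<alpha>) (sequentially \<times>\<^sub>F ?G)"
    by (rule filterlim_mono[OF filterlim_snd[where G = ?G]]) auto
  have bound: "((\<lambda>z. \<gamma> ^ fst z * C + \<bar>snd z - \<alpha>\<bar> * K / (1 - \<gamma>)) \<longlongrightarrow> 0) (sequentially \<times>\<^sub>F ?G)"
  proof (rule tendsto_add_zero)
    show "((\<lambda>z. \<gamma> ^ fst z * C) \<longlongrightarrow> 0) (sequentially \<times>\<^sub>F ?G)"
      using \<gamma> by (intro tendsto_mult_left_zero filterlim_compose[OF LIMSEQ_power_zero lim_n]) auto
    have "((\<lambda>z. \<bar>snd z - \<alpha>\<bar> * K / (1 - \<gamma>)) \<longlongrightarrow> \<bar>\<alpha> - \<alpha>\<bar> * K / (1 - \<gamma>)) (sequentially \<times>\<^sub>F ?G)"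
      using \<gamma> by (intro tendsto_divide tendsto_mult tendsto_rabs tendsto_diff tendsto_const lim_\<beta>) auto
    then show "((\<lambda>z. \<bar>snd z - \<alpha>\<bar> * K / (1 - \<gamma>)) \<longlongrightarrow> 0) (sequentially \<times>\<^sub>F ?G)" by simp
  qed
  have "\<forall>\<^sub>F \<beta> in ?G. \<beta> \<in> {0..<1}"
    by (simp add: eventually_inf_principal)
  moreover have "\<forall>\<^sub>F \<beta> in ?G. \<beta> < \<gamma>"
    unfolding eventually_inf_principal
    by (rule eventually_mono[OF eventually_nhds_in_open[of "{..<\<gamma>}"]]) (use \<gamma>(2) in auto)
  ultimately have ev: "\<forall>\<^sub>F \<beta> in ?G. 0 \<le> \<beta> \<and> \<beta> \<le> \<gamma>"
    by eventually_elim auto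
  have "\<forall>\<^sub>F z in sequentially \<times>\<^sub>F ?G. 0 \<le> snd z \<and> snd z \<le> \<gamma>"
    using eventually_compose_filterlim[OF ev filterlim_snd] .
  then have le: "\<forall>\<^sub>F z in sequentially \<times>\<^sub>F ?G.
      norm (horizon_value M (snd z) (fst z) $ x - opt_value M \<alpha> $ x)
        \<le> \<gamma> ^ fst z * C + \<bar>snd z - \<alpha>\<bar> * K / (1 - \<gamma>)" for x
    by eventually_elim (use horizon_value_error[OF \<alpha> _ _ \<gamma>(3) C K] in auto)
  have "((\<lambda>z. horizon_value M (snd z) (fst z) $ x) \<longlongrightarrow> opt_value M \<alpha> $ x) (sequentially \<times>\<^sub>F ?G)" for x
    by (rule LIM_zero_cancel[OF Lim_null_comparison[OF le bound]])
  then show ?thesis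
    by (rule vec_tendstoI)
qed

section \<open>The turnpike function\<close>

text \<open>For a rule outside D(\<alpha>), the defect in the equation defining
  \<open>horizon_opt\<close> has a nonzero joint limit, so it is eventually nonzero. Finitely many
  rules allow a common threshold.\<close>

lemma horizon_opt_subset_discount_opt:
  assumes \<alpha>: "0 \<le> \<alpha>" "\<alpha> < 1"
  obtains N e where "e > 0"
    "\<And>n \<beta>. N \<le> n \<Longrightarrow> \<beta> \<in> {0..<1} \<Longrightarrow> \<bar>\<beta> - \<alpha>\<bar> < e \<Longrightarrow> horizon_opt M n \<beta> \<subseteq> discount_opt M \<alpha>"
proof -
  let ?G = "inf (nhds \<alpha>) (principal {0..<1::real})"
  let ?F = "sequentially \<times>\<^sub>F ?G"
  let ?V = "\<lambda>n \<beta>. horizon_value M \<beta> n"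
  have limV: "((\<lambda>z. ?V (fst z) (snd z)) \<longlongrightarrow> opt_value M \<alpha>) ?F"
    by (rule tendsto_horizon_value_opt_value[OF \<alpha>])
  have lim_\<beta>: "filterlim snd (nhds \<alpha>) ?F"
    by (rule filterlim_mono[OF filterlim_snd[where G = ?G]]) auto
  have lim_Suc: "filterlim (\<lambda>z. (Suc (fst z), snd z)) ?F ?F"
    by (intro filterlim_Pair filterlim_compose[OF filterlim_Suc filterlim_fst] filterlim_snd)
  have limV': "((\<lambda>z. ?V (Suc (fst z)) (snd z)) \<longlongrightarrow> opt_value M \<alpha>) ?F"
    using filterlim_compose[OF limV lim_Suc] by simp
  have "\<forall>\<^sub>F z in ?F. ?V (Suc (fst z)) (snd z) \<noteq> bellman_op M (snd z) \<phi> (?V (fst z) (snd z))"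
    if \<phi>: "\<phi> \<in> decision_rules M - discount_opt M \<alpha>" for \<phi>
  proof -
    have "opt_value M \<alpha> - bellman_op M \<alpha> \<phi> (opt_value M \<alpha>) \<noteq> 0"
      using discount_opt_of_bellman_op[OF \<alpha>, of \<phi>] \<phi> by auto
    from tendsto_imp_eventually_ne[OF tendsto_diff[OF limV' tendsto_bellman_op[OF lim_\<beta> limV, of \<phi>]] this]
    show ?thesis by simp
  qed
  then have "\<forall>\<^sub>F z in ?F. \<forall>\<phi>\<in>decision_rules M - discount_opt M \<alpha>.
      ?V (Suc (fst z)) (snd z) \<noteq> bellman_op M (snd z) \<phi> (?V (fst z) (snd z))"
    using finite_decision_rules by (intro eventually_ball_finite) auto
  then obtain P Q where P: "eventually P sequentially" and Q: "eventually Q ?G"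
    and PQ: "\<And>n \<beta> \<phi>. P n \<Longrightarrow> Q \<beta> \<Longrightarrow> \<phi> \<in> decision_rules M - discount_opt M \<alpha> \<Longrightarrow>
      ?V (Suc n) \<beta> \<noteq> bellman_op M \<beta> \<phi> (?V n \<beta>)"
    unfolding eventually_prod_filter by fastforce
  from P obtain N where N: "\<And>n. N \<le> n \<Longrightarrow> P n"
    by (auto simp: eventually_sequentially)
  from Q obtain e where e: "e > 0" "\<And>\<beta>. \<beta> \<in> {0..<1} \<Longrightarrow> \<bar>\<beta> - \<alpha>\<bar> < e \<Longrightarrow> Q \<beta>"
    by (auto simp: eventually_inf_principal eventually_nhds_metric dist_real_def)
  \<comment> \<open>The threshold is \<open>Suc N\<close> because \<open>PQ\<close> at
    \<open>m\<close> concerns the horizon \<open>Suc m\<close>.\<close>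
  have "horizon_opt M n \<beta> \<subseteq> discount_opt M \<alpha>"
    if "Suc N \<le> n" "\<beta> \<in> {0..<1}" "\<bar>\<beta> - \<alpha>\<bar> < e" for n \<beta>
  proof -
    from that(1) obtain m where "n = Suc m" "N \<le> m" by (cases n) auto
    then show ?thesis
      using PQ[OF N e(2)[OF that(2,3)], of m] by (auto simp: horizon_opt_def simp del: horizon_value.simps)
  qed
  with e(1) show thesis by (rule that)
qed

text \<open>For a fixed horizon both sides of the defining equation are continuous in the discount
  factor, so a rule that violates it at \<alpha> violates it nearby.\<close>

lemma horizon_opt_eventually_subset:
  assumes "n \<ge> 1"
  shows "\<forall>\<^sub>F \<beta> in at \<alpha> within {0..<1}. horizon_opt M n \<beta> \<subseteq> horizon_opt M n \<alpha>"
proof -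
  let ?F = "at \<alpha> within {0..<1::real}"
  have "\<forall>\<^sub>F \<beta> in ?F. horizon_value M \<beta> n \<noteq> bellman_op M \<beta> \<phi> (horizon_value M \<beta> (n - 1))"
    if "\<phi> \<in> decision_rules M - horizon_opt M n \<alpha>" for \<phi>
  proof -
    have ne: "horizon_value M \<alpha> n - bellman_op M \<alpha> \<phi> (horizon_value M \<alpha> (n - 1)) \<noteq> 0"
      using that by (auto simp: horizon_opt_def)
    have "((\<lambda>\<beta>. horizon_value M \<beta> n - bellman_op M \<beta> \<phi> (horizon_value M \<beta> (n - 1))) \<longlongrightarrow>
        horizon_value M \<alpha> n - bellman_op M \<alpha> \<phi> (horizon_value M \<alpha> (n - 1))) ?F"
      by (intro tendsto_diff tendsto_bellman_op tendsto_horizon_value tendsto_ident_at)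
    from tendsto_imp_eventually_ne[OF this ne] show ?thesis by simp
  qed
  then have "\<forall>\<^sub>F \<beta> in ?F. \<forall>\<phi>\<in>decision_rules M - horizon_opt M n \<alpha>.
      horizon_value M \<beta> n \<noteq> bellman_op M \<beta> \<phi> (horizon_value M \<beta> (n - 1))"
    using finite_decision_rules by (intro eventually_ball_finite) auto
  then show ?thesis
    by eventually_elim (auto simp: horizon_opt_def)
qed

text \<open>The case \<beta> = \<alpha> of \<open>horizon_opt_subset_discount_opt\<close> supplies
  an admissible integer, so the \<open>LEAST\<close> in \<open>turnpike\<close> is attained.\<close>

lemma turnpike_exists:
  assumes "0 \<le> \<alpha>" "\<alpha> < 1"
  shows "turnpike M \<alpha> \<ge> 1" "turnpike M \<alpha> \<le> n \<Longrightarrow> horizon_opt M n \<alpha> \<subseteq> discount_opt M \<alpha>"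
proof -
  obtain N e where "e > 0"
    "\<And>n \<beta>. N \<le> n \<Longrightarrow> \<beta> \<in> {0..<1} \<Longrightarrow> \<bar>\<beta> - \<alpha>\<bar> < e \<Longrightarrow> horizon_opt M n \<beta> \<subseteq> discount_opt M \<alpha>"
    by (rule horizon_opt_subset_discount_opt[OF assms]) blast
  then have "Suc N \<ge> 1 \<and> (\<forall>n\<ge>Suc N. horizon_opt M n \<alpha> \<subseteq> discount_opt M \<alpha>)"
    using assms by simp
  from LeastI[of "\<lambda>N. N \<ge> 1 \<and> (\<forall>n\<ge>N. horizon_opt M n \<alpha> \<subseteq> discount_opt M \<alpha>)", OF this]
  show "turnpike M \<alpha> \<ge> 1" "turnpike M \<alpha> \<le> n \<Longrightarrow> horizon_opt M n \<alpha> \<subseteq> discount_opt M \<alpha>"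
    unfolding turnpike_def by blast+
qed

text \<open>The chain \<open>horizon_opt M n \<beta> \<subseteq> discount_opt M \<alpha> \<subseteq>
  discount_opt M \<beta>\<close> for all \<open>n \<ge> turnpike M \<alpha>\<close> makes
  \<open>turnpike M \<alpha>\<close> an admissible integer at \<beta>.\<close>

lemma turnpike_eventually_le:
  assumes reg: "regular_point M \<alpha>"
  shows "\<forall>\<^sub>F \<beta> in at \<alpha> within {0..<1}. turnpike M \<beta> \<le> turnpike M \<alpha>"
proof -
  let ?F = "at \<alpha> within {0..<1::real}"
  have \<alpha>: "0 \<le> \<alpha>" "\<alpha> < 1"
    using reg by (auto simp: regular_point_def)
  obtain d where d: "d > 0"
    "\<And>\<beta>. \<beta> \<in> {0..<1} \<Longrightarrow> \<bar>\<beta> - \<alpha>\<bar> < d \<Longrightarrow> discount_opt M \<alpha> \<subseteq> discount_opt M \<beta>"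
    by (rule discount_opt_regular_subset[OF reg]) blast
  obtain N e where e: "e > 0"
    "\<And>n \<beta>. N \<le> n \<Longrightarrow> \<beta> \<in> {0..<1} \<Longrightarrow> \<bar>\<beta> - \<alpha>\<bar> < e \<Longrightarrow> horizon_opt M n \<beta> \<subseteq> discount_opt M \<alpha>"
    by (rule horizon_opt_subset_discount_opt[OF \<alpha>]) blast
  have "\<forall>\<^sub>F \<beta> in ?F. \<forall>n\<in>{turnpike M \<alpha>..<N}. horizon_opt M n \<beta> \<subseteq> horizon_opt M n \<alpha>"
    using turnpike_exists(1)[OF \<alpha>] by (intro eventually_ball_finite ballI horizon_opt_eventually_subset) auto
  moreover have "\<forall>\<^sub>F \<beta> in ?F. \<beta> \<in> {0..<1} \<and> \<bar>\<beta> - \<alpha>\<bar> < min d e"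
    using d(1) e(1) by (auto simp: eventually_at dist_real_def intro!: exI[of _ "min d e"])
  ultimately show ?thesis
  proof eventually_elim
    case (elim \<beta>)
    have "horizon_opt M n \<beta> \<subseteq> discount_opt M \<beta>" if "turnpike M \<alpha> \<le> n" for n
    proof -
      have "horizon_opt M n \<beta> \<subseteq> discount_opt M \<alpha>"
      proof (cases "N \<le> n")
        case True
        then show ?thesis using e(2) elim by simp
      next
        case False
        then have "horizon_opt M n \<beta> \<subseteq> horizon_opt M n \<alpha>"
          using elim(1) that by auto
        with turnpike_exists(2)[OF \<alpha> that] show ?thesis by blast
      qed
      with d(2) elim(2) show ?thesis by fastforce
    qed
    with turnpike_exists(1)[OF \<alpha>] show ?case
      unfolding turnpike_def[of M \<beta>] by (intro Least_le) blast
  qed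
qed

text \<open>By monotonicity every enumerated point is at most \<open>a i\<close> or at least
  \<open>a (Suc i)\<close>, so none lies inside the interval, and the enumeration contains every
  irregular point of (0,1).\<close>

lemma partition_interval_regular:
  assumes "I \<in> partition_intervals M" "\<beta> \<in> I"
  shows "\<beta> \<in> {0<..<1}" "regular_point M \<beta>"
proof -
  from assms obtain a l i where mono: "strict_mono_on {0..l} a" and ends: "a 0 = 0" "a l = 1"
    and irreg: "a ` {0<..<l} = {\<alpha> \<in> {0<..<1}. irregular_point M \<alpha>}" and i: "i < l"
    and \<beta>: "a i < \<beta>" "\<beta> < a (Suc i)"
    unfolding partition_intervals_def by auto
  have le: "a j \<le> a k" if "j \<le> k" "k \<le> l" for j k
    using strict_mono_on_leD[OF mono, of j k] that by auto
  from le[of 0 i] le[of "Suc i" l] i ends \<beta> show \<beta>01: "\<beta> \<in> {0<..<1}" by auto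
  have "\<beta> \<noteq> a j" if "j \<le> l" for j
    using le[of j i] le[of "Suc i" j] that i \<beta> by (cases "j \<le> i") auto
  then have "\<beta> \<notin> a ` {0<..<l}"
    by (metis greaterThanLessThan_iff imageE less_imp_le)
  with irreg \<beta>01 show "regular_point M \<beta>"
    by (auto simp: regular_point_def)
qed

end

theorem theorem4p6:
  fixes M :: "('x::finite, 'a) mdp"
  assumes "finite_mdp M"
  shows "(\<forall>\<alpha>. regular_point M \<alpha> \<longrightarrow>
            usc_at_within \<alpha> {0..<1} (\<lambda>\<beta>. real (turnpike M \<beta>))) \<and>
         (\<forall>I\<in>partition_intervals M. usc_on I (\<lambda>\<beta>. real (turnpike M \<beta>)))"
proof -
  have reg: "usc_at_within \<alpha> {0..<1} (\<lambda>\<beta>. real (turnpike M \<beta>))" if "regular_point M \<alpha>" for \<alpha>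
    unfolding usc_at_within_def
    using turnpike_eventually_le[OF assms that] by (auto elim!: eventually_mono)
  have "usc_at_within \<alpha> I (\<lambda>\<beta>. real (turnpike M \<beta>))"
    if I: "I \<in> partition_intervals M" and "\<alpha> \<in> I" for I \<alpha>
  proof -
    \<comment> \<open>Restricting the domain makes the neighbourhood filter finer, so semicontinuity
      relative to [0,1) passes to \<open>I\<close>.\<close>
    have "I \<subseteq> {0..<1}"
      using partition_interval_regular(1)[OF assms I] by fastforce
    then show ?thesis
      using reg[OF partition_interval_regular(2)[OF assms that]]
      by (auto simp: usc_at_within_def intro: filter_leD[OF at_le])
  qed
  with reg show ?thesis by (auto simp: usc_on_def)
qed

end
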